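(* Let $R$ be a commutative ring with $1$ and let $(M,\operatorname{rk},m)$ be a ranked set with multiplicities. Then, as an identity in $R(x,y)$, \[ \mathfrak{M}_M(x,y)=\sum_{A\subseteq M}\mathfrak{M}_{M|_A}(0,y)\,T_{M/A}(x,0)=\sum_{A\subseteq M}T_{M|_A}(0,y)\,\mathfrak{M}_{M/A}(x,0). \]
   Context: A ranked set with multiplicities is a triple $(M,\operatorname{rk},m)$ where $M$ is a finite set, $\operatorname{rk}:2^M\to\mathbb{Z}$ is any function with $\operatorname{rk}(\emptyset)=0$, and $m:2^M\to R$ is any function. For $A\subseteq M$, the restriction $M|_A$ is $(A,\operatorname{rk}|_{2^A},m|_{2^A})$, and the contraction $M/A$ is $(M\setminus A,\operatorname{rk}_{M/A},m_{M/A})$ with $\operatorname{rk}_{M/A}(B)=\operatorname{rk}(B\cup A)-\operatorname{rk}(A)$ and $m_{M/A}(B)=m(B\cup A)$ for $B\subseteq M\setminus A$. Write $\operatorname{rk}(M)$ for the rank of the whole ground set. The arithmetic Tutte function is $\mathfrak{M}_M(x,y)=\sum_{A\subseteq M}m(A)(x-1)^{\operatorname{rk}(M)-\operatorname{rk}(A)}(y-1)^{|A|-\operatorname{rk}(A)}\in R(x,y)$ and the Tutte function is $T_M(x,y)=\sum_{A\subseteq M}(x-1)^{\operatorname{rk}(M)-\operatorname{rk}(A)}(y-1)^{|A|-\operatorname{rk}(A)}\in R(x,y)$ (exponents may be negative). Substituting $x=0$ (resp. $y=0$) replaces $(x-1)^k$ by $(-1)^k$ (resp. $(y-1)^k$ by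 $(-1)^k$). *)

theory Defs
  imports "HOL-Computational_Algebra.Polynomial"
begin

section \<open>The total ring of fractions of a commutative ring\<close>

text \<open>
  \<open>HOL-Computational_Algebra.Fraction_Field\<close> requires an integral domain. For an arbitrary
  commutative ring we invert the elements that are not zero divisors; for an integral domain this
  is the usual field of fractions.
\<close>

definition regular_elem :: "'a::comm_ring_1 \<Rightarrow> bool" where
  "regular_elem s \<longleftrightarrow> (\<forall>a. a * s = 0 \<longrightarrow> a = 0)"

lemma regular_elem_1 [simp]: "regular_elem 1"
  by (simp add: regular_elem_def)

lemma regular_elem_cancel:
  assumes "regular_elem s" shows "a * s = b * s \<longleftrightarrow> a = b"
proof
  assume "a * s = b * s"
  then have "(a - b) * s = 0" by (simp add: algebra_simps)
  then show "a = b" using assms unfolding regular_elem_def by (metis eq_iff_diff_eq_0)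
qed simp

lemma regular_elem_mult [simp]: "regular_elem (s * t) \<longleftrightarrow> regular_elem s \<and> regular_elem t"
proof
  assume st: "regular_elem (s * t)"
  show "regular_elem s \<and> regular_elem t"
    unfolding regular_elem_def
  proof (intro conjI allI impI)
    fix a assume "a * s = 0"
    then have "a * (s * t) = 0" by (simp add: mult.assoc [symmetric])
    then show "a = 0" using st unfolding regular_elem_def by blast
  next
    fix a assume "a * t = 0"
    then have "s * (a * t) = 0" by simp
    then have "a * (s * t) = 0" by (simp only: mult.left_commute [of a s t])
    then show "a = 0" using st unfolding regular_elem_def by blast
  qed
next
  assume "regular_elem s \<and> regular_elem t"
  then show "regular_elem (s * t)"
    unfolding regular_elem_def by (metis mult.assoc)
qed

definition fracrel :: "'a::comm_ring_1 \<times> 'a \<Rightarrow> 'a \<times> 'a \<Rightarrow> bool" where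
  "fracrel p q \<longleftrightarrow>
     regular_elem (snd p) \<and> regular_elem (snd q) \<and> fst p * snd q = fst q * snd p"

lemma part_equivp_fracrel: "part_equivp (fracrel :: 'a::comm_ring_1 \<times> 'a \<Rightarrow> _)"
proof (rule part_equivpI)
  show "\<exists>p :: 'a \<times> 'a. fracrel p p"
    by (rule exI [of _ "(0, 1)"]) (simp add: fracrel_def)
  show "symp (fracrel :: 'a \<times> 'a \<Rightarrow> _)"
    by (simp add: symp_def fracrel_def)
  show "transp (fracrel :: 'a \<times> 'a \<Rightarrow> _)"
  proof (rule transpI, unfold split_paired_all)
    fix a b a' b' a'' b'' :: 'a
    assume A: "fracrel (a, b) (a', b')" and B: "fracrel (a', b') (a'', b'')"
    have "a * b'' * b' = (a * b') * b''" by (simp add: ac_simps)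
    also have "\<dots> = (a' * b'') * b" using A by (simp add: fracrel_def ac_simps)
    also have "\<dots> = a'' * b * b'" using B by (simp add: fracrel_def ac_simps)
    finally have "a * b'' = a'' * b" using A by (simp add: fracrel_def regular_elem_cancel)
    with A B show "fracrel (a, b) (a'', b'')" by (simp add: fracrel_def)
  qed
qed

quotient_type (overloaded) 'a total_fract = "'a::comm_ring_1 \<times> 'a" / partial: fracrel
  by (rule part_equivp_fracrel)

lift_definition to_fract :: "'a::comm_ring_1 \<Rightarrow> 'a total_fract" is "\<lambda>a. (a, 1)"
  by (simp add: fracrel_def)

instantiation total_fract :: (comm_ring_1) comm_ring_1
begin

lift_definition zero_total_fract :: "'a total_fract" is "(0, 1)"
  by (simp add: fracrel_def)

lift_definition one_total_fract :: "'a total_fract" is "(1, 1)"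
  by (simp add: fracrel_def)

lift_definition plus_total_fract :: "'a total_fract \<Rightarrow> 'a total_fract \<Rightarrow> 'a total_fract"
  is "\<lambda>p q. (fst p * snd q + fst q * snd p, snd p * snd q)"
proof -
  fix p p' q q' :: "'a \<times> 'a"
  assume A: "fracrel p p'" and B: "fracrel q q'"
  have "(fst p * snd q + fst q * snd p) * (snd p' * snd q')
      = (fst p * snd p') * (snd q * snd q') + (fst q * snd q') * (snd p * snd p')"
    by (simp add: algebra_simps)
  also have "\<dots> = (fst p' * snd p) * (snd q * snd q') + (fst q' * snd q) * (snd p * snd p')"
    using A B by (simp add: fracrel_def)
  also have "\<dots> = (fst p' * snd q' + fst q' * snd p') * (snd p * snd q)"
    by (simp add: algebra_simps)
  finally show "fracrel (fst p * snd q + fst q * snd p, snd p * snd q)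
      (fst p' * snd q' + fst q' * snd p', snd p' * snd q')"
    using A B by (simp add: fracrel_def)
qed

lift_definition uminus_total_fract :: "'a total_fract \<Rightarrow> 'a total_fract"
  is "\<lambda>p. (- fst p, snd p)"
  by (simp add: fracrel_def)

definition minus_total_fract :: "'a total_fract \<Rightarrow> 'a total_fract \<Rightarrow> 'a total_fract"
  where "minus_total_fract p q = p + - q"

lift_definition times_total_fract :: "'a total_fract \<Rightarrow> 'a total_fract \<Rightarrow> 'a total_fract"
  is "\<lambda>p q. (fst p * fst q, snd p * snd q)"
proof -
  fix p p' q q' :: "'a \<times> 'a"
  assume A: "fracrel p p'" and B: "fracrel q q'"
  have "(fst p * fst q) * (snd p' * snd q') = (fst p * snd p') * (fst q * snd q')"
    by (simp add: ac_simps)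
  also have "\<dots> = (fst p' * snd p) * (fst q' * snd q)"
    using A B by (simp add: fracrel_def)
  also have "\<dots> = (fst p' * fst q') * (snd p * snd q)"
    by (simp add: ac_simps)
  finally show "fracrel (fst p * fst q, snd p * snd q) (fst p' * fst q', snd p' * snd q')"
    using A B by (simp add: fracrel_def)
qed

instance
proof
  fix p q r :: "'a total_fract"
  show "(p * q) * r = p * (q * r)" by transfer (simp add: fracrel_def algebra_simps)
  show "p * q = q * p" by transfer (simp add: fracrel_def algebra_simps)
  show "1 * p = p" by transfer (simp add: fracrel_def)
  show "(p + q) + r = p + (q + r)" by transfer (simp add: fracrel_def algebra_simps)
  show "p + q = q + p" by transfer (simp add: fracrel_def algebra_simps)
  show "0 + p = p" by transfer (simp add: fracrel_def)
  show "- p + p = 0" by transfer (simp add: fracrel_def)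
  show "p - q = p + - q" by (simp add: minus_total_fract_def)
  show "(p + q) * r = p * r + q * r" by transfer (simp add: fracrel_def algebra_simps)
  show "(0 :: 'a total_fract) \<noteq> 1" by transfer (simp add: fracrel_def)
qed

end

text \<open>
  As usual in HOL, \<open>inverse\<close> is totalised by the value \<open>0\<close> on non-units. With this instance,
  \<open>u powi k\<close> is the integer power of a unit \<open>u\<close>.
\<close>

instantiation total_fract :: (comm_ring_1) inverse
begin

lift_definition inverse_total_fract :: "'a total_fract \<Rightarrow> 'a total_fract"
  is "\<lambda>p. if regular_elem (fst p) then (snd p, fst p) else (0, 1)"
proof -
  fix p q :: "'a \<times> 'a"
  assume A: "fracrel p q"
  have "regular_elem (snd p)" "regular_elem (snd q)"
    using A by (simp_all add: fracrel_def)
  then have "regular_elem (fst p) \<longleftrightarrow> regular_elem (fst p * snd q)"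
    by simp
  also have "fst p * snd q = fst q * snd p"
    using A by (simp add: fracrel_def)
  also have "regular_elem \<dots> \<longleftrightarrow> regular_elem (fst q)"
    using \<open>regular_elem (snd p)\<close> by simp
  finally have "regular_elem (fst p) \<longleftrightarrow> regular_elem (fst q)" .
  then show "fracrel (if regular_elem (fst p) then (snd p, fst p) else (0, 1))
      (if regular_elem (fst q) then (snd q, fst q) else (0, 1))"
    using A by (simp add: fracrel_def mult.commute)
qed

definition divide_total_fract :: "'a total_fract \<Rightarrow> 'a total_fract \<Rightarrow> 'a total_fract"
  where "divide_total_fract p q = p * inverse q"

instance ..

end

lemma inverse_total_fract_unique:
  fixes u v :: "'a::comm_ring_1 total_fract"
  assumes "u * v = 1" shows "inverse u = v"
  using assms
proof transfer
  fix u v :: "'a \<times> 'a"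
  assume u: "fracrel u u" and v: "fracrel v v"
    and "fracrel (fst u * fst v, snd u * snd v) (1, 1)"
  then have eq: "fst u * fst v = snd u * snd v" by (simp add: fracrel_def)
  then have "regular_elem (fst u * fst v)" using u v by (simp add: fracrel_def)
  then have "regular_elem (fst u)" by simp
  then show "fracrel (if regular_elem (fst u) then (snd u, fst u) else (0, 1)) v"
    using u v eq by (simp add: fracrel_def mult.commute)
qed


section \<open>The ring \<open>R(x,y)\<close>\<close>

text \<open>\<open>'r poly poly\<close> is \<open>R[x][y]\<close>: the inner variable is \<open>x\<close>, the outer one is \<open>y\<close>.\<close>

type_synonym 'r ratfun = "'r poly poly total_fract"

definition Const :: "'r::comm_ring_1 \<Rightarrow> 'r ratfun" where
  "Const c = to_fract [:[:c:]:]"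

definition var_x :: "'r::comm_ring_1 ratfun" where
  "var_x = to_fract [:[:0, 1:]:]"

definition var_y :: "'r::comm_ring_1 ratfun" where
  "var_y = to_fract [:0, 1:]"

text \<open>
  Monic polynomials are not zero divisors, so \<open>x - 1\<close> and \<open>y - 1\<close> are invertible in \<open>R(x,y)\<close>
  over every \<open>R\<close>.
\<close>

lemma regular_elem_linear: "regular_elem [:- 1, 1 :: 'a::comm_ring_1:]"
  unfolding regular_elem_def
proof (intro allI impI, rule ccontr)
  fix p :: "'a poly" assume 0: "p * [:- 1, 1:] = 0" and "p \<noteq> 0"
  have "coeff (p * [:- 1, 1:]) (Suc (degree p)) = lead_coeff p"
    by (simp add: coeff_eq_0)
  with 0 \<open>p \<noteq> 0\<close> show False by simp
qed

lemma regular_elem_const_poly: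
  assumes "regular_elem s" shows "regular_elem [:s:]"
  unfolding regular_elem_def
proof (intro allI impI)
  fix p assume "p * [:s:] = 0"
  then have "coeff p i * s = 0" for i by (simp add: poly_eq_iff mult.commute)
  then have "coeff p i = 0" for i using assms unfolding regular_elem_def by blast
  then show "p = 0" by (simp add: poly_eq_iff)
qed

lemma to_fract_inverse:
  assumes "regular_elem s" shows "to_fract s * inverse (to_fract s) = 1"
  using assms by transfer (simp add: fracrel_def)

lemma to_fract_minus_1: "to_fract p - 1 = to_fract (p - 1)"
  unfolding minus_total_fract_def by transfer (simp add: fracrel_def)

lemma var_x_minus_1: "var_x - 1 = to_fract [:[:- 1, 1:]:]"
  by (simp add: var_x_def to_fract_minus_1 flip: pCons_one)

lemma var_y_minus_1: "var_y - 1 = to_fract [:- 1, 1:]"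
proof -
  have "[:0, 1:] - 1 = ([:- 1, 1:] :: 'a poly poly)"
    by (subst (2) pCons_one [symmetric]) simp
  then show ?thesis by (simp add: var_y_def to_fract_minus_1)
qed

lemma inverse_var_x_minus_1: "(var_x - 1) * inverse (var_x - 1) = 1"
  by (simp add: var_x_minus_1 to_fract_inverse regular_elem_const_poly regular_elem_linear)

lemma inverse_var_y_minus_1: "(var_y - 1) * inverse (var_y - 1) = 1"
  by (simp add: var_y_minus_1 to_fract_inverse regular_elem_linear)


section \<open>Ranked sets with multiplicities\<close>

text \<open>
  The functions \<open>rk\<close> and \<open>mult\<close> live on the subsets of the ground set; their values on other sets
  are irrelevant, so restriction need not change them.
\<close>

record ('e, 'r) ranked_set =
  ground :: "'e set"
  rk :: "'e set \<Rightarrow> int"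
  mult :: "'e set \<Rightarrow> 'r"

definition ranked_set_with_multiplicities :: "('e, 'r) ranked_set \<Rightarrow> bool" where
  "ranked_set_with_multiplicities M \<longleftrightarrow> finite (ground M) \<and> rk M {} = 0"

definition restriction :: "('e, 'r) ranked_set \<Rightarrow> 'e set \<Rightarrow> ('e, 'r) ranked_set" where
  "restriction M A = \<lparr>ground = A, rk = rk M, mult = mult M\<rparr>"

definition contraction :: "('e, 'r) ranked_set \<Rightarrow> 'e set \<Rightarrow> ('e, 'r) ranked_set" where
  "contraction M A =
     \<lparr>ground = ground M - A,
      rk = (\<lambda>B. rk M (B \<union> A) - rk M A),
      mult = (\<lambda>B. mult M (B \<union> A))\<rparr>"

text \<open>
  Both functions take the values to be substituted for \<open>x\<close> and \<open>y\<close> as arguments: the Tutte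
  functions themselves are obtained at \<open>var_x\<close> and \<open>var_y\<close>, and \<open>X = 0\<close> replaces
  \<open>(x - 1)\<^sup>k\<close> by \<open>(-1)\<^sup>k\<close>. The arguments must be such that \<open>X - 1\<close> and \<open>Y - 1\<close> are units.
\<close>

definition arith_tutte ::
  "('e, 'r::comm_ring_1) ranked_set \<Rightarrow> 'r ratfun \<Rightarrow> 'r ratfun \<Rightarrow> 'r ratfun" where
  "arith_tutte M X Y =
     (\<Sum>A\<in>Pow (ground M). Const (mult M A)
        * (X - 1) powi (rk M (ground M) - rk M A)
        * (Y - 1) powi (int (card A) - rk M A))"

definition tutte ::
  "('e, 'r::comm_ring_1) ranked_set \<Rightarrow> 'r ratfun \<Rightarrow> 'r ratfun \<Rightarrow> 'r ratfun" where
  "tutte M X Y =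
     (\<Sum>A\<in>Pow (ground M).
        (X - 1) powi (rk M (ground M) - rk M A)
        * (Y - 1) powi (int (card A) - rk M A))"

end

theory Submission
  imports Defs
begin

text \<open>
  Expand the products of the right-hand side over chains \<open>B \<subseteq> A \<subseteq> D\<close>, where \<open>D = C \<union> A\<close> for the
  summation set \<open>C\<close> of the contraction. The powers of \<open>- 1\<close> have total exponent
  \<open>rk A - rk B + \<bar>D - A\<bar> - rk D + rk A\<close>, whose parity depends on \<open>A\<close> only through \<open>\<bar>A\<bar>\<close>.
  Hence the sum over \<open>A\<close> is an alternating sum over the interval between \<open>B\<close> and \<open>D\<close>, which
  vanishes unless \<open>B = D\<close>; the diagonal terms are those of the left-hand side.
\<close>

text \<open>If \<open>B\<close> is a proper subset of \<open>D\<close>, toggling a fixed element of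
  \<open>D - B\<close> pairs the even sets of the interval with the odd ones, so the signs cancel.
  If \<open>B\<close> is not contained in \<open>D\<close>, the interval is empty.\<close>

lemma sum_alternating_interval:
  assumes "finite E" "B \<subseteq> E" "D \<subseteq> E"
  shows "(\<Sum>A | A \<subseteq> E \<and> B \<subseteq> A \<and> A \<subseteq> D. (- 1) ^ card A) =
           (if B = D then (- 1) ^ card B else (0 :: 'c :: comm_ring_1))"
proof -
  have *: "{A. A \<subseteq> E \<and> B \<subseteq> A \<and> A \<subseteq> D} = {A. A \<subseteq> D \<and> B \<subseteq> A}"
    using assms by auto
  have D: "finite D"
    using assms finite_subset by blast
  consider "B = D" | "B \<subset> D" | "\<not> B \<subseteq> D"
    by blast
  then show ?thesis
  proof cases
    case 1
    then have "{A. A \<subseteq> D \<and> B \<subseteq> A} = {D}"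
      by auto
    with 1 show ?thesis
      unfolding * by simp
  next
    case 2
    then show ?thesis
      unfolding * using D card_subsupersets_even_odd [OF D 2]
      by (simp add: sum_alternating_cancels)
  next
    case 3
    then have empty: "{A. A \<subseteq> D \<and> B \<subseteq> A} = {}"
      by auto
    show ?thesis
      unfolding * empty using 3 by auto
  qed
qed

text \<open>Reindexing along the bijection between \<open>C\<close> and \<open>C \<union> A\<close>.
  The summand \<open>h\<close> takes both sets because the sign in the contraction involves
  \<open>card C\<close>, while the weight and the rank involve the union.\<close>

lemma sum_contraction_eq_sum_superset:
  assumes "A \<subseteq> E"
  shows "(\<Sum>C\<in>Pow (E - A). h C (C \<union> A)) = (\<Sum>D | D \<in> Pow E \<and> A \<subseteq> D. h (D - A) D)"
proof -
  have "(C \<union> A) - A = C" if "C \<subseteq> E - A" for C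
    using that by auto
  then show ?thesis
    using assms
    by (intro sum.reindex_bij_witness [of _ "\<lambda>D. D - A" "\<lambda>C. C \<union> A"]) auto
qed

text \<open>The combinatorial core of both identities: the weights \<open>f\<close> and
  \<open>g\<close> are arbitrary, so multiplicities and powers of \<open>var_x - 1\<close> and
  \<open>var_y - 1\<close> can be absorbed into either one. Exponents of \<open>- 1\<close> matter
  only modulo 2, hence the absolute values.\<close>

lemma convolution_rank_signs:
  fixes f g :: "'e set \<Rightarrow> 'c :: comm_ring_1" and r :: "'e set \<Rightarrow> int"
  assumes E: "finite E"
  shows "(\<Sum>A\<in>Pow E.
            (\<Sum>B\<in>Pow A. f B * (- 1) ^ nat \<bar>r A - r B\<bar>) *
            (\<Sum>C\<in>Pow (E - A). g (C \<union> A) * (- 1) ^ nat \<bar>int (card C) - (r (C \<union> A) - r A)\<bar>)) =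
         (\<Sum>A\<in>Pow E. f A * g A)"
proof -
  \<comment> \<open>The part of the sign that is independent of \<open>A\<close>: modulo 2 the two
    occurrences of \<open>r A\<close> cancel, and \<open>card (D - A)\<close> splits into
    \<open>card D\<close> and \<open>card A\<close>.\<close>
  define s :: "'e set \<Rightarrow> 'e set \<Rightarrow> 'c"
    where "s B D = (- 1) ^ nat \<bar>int (card D) - r B - r D\<bar>" for B D
  have signs: "(- 1) ^ nat \<bar>r A - r B\<bar> * (- 1) ^ nat \<bar>int (card (D - A)) - (r D - r A)\<bar> =
      s B D * (- 1) ^ card A" if "D \<subseteq> E" "A \<subseteq> D" for A B D
  proof -
    have "finite A" "finite D"
      using that E by (meson finite_subset)+
    then have "int (card (D - A)) = int (card D) - int (card A)"
      using that by (simp add: card_Diff_subset card_mono of_nat_diff)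
    then show ?thesis
      by (auto simp: s_def minus_one_power_iff even_nat_iff)
  qed
  have "(\<Sum>A\<in>Pow E.
            (\<Sum>B\<in>Pow A. f B * (- 1) ^ nat \<bar>r A - r B\<bar>) *
            (\<Sum>C\<in>Pow (E - A). g (C \<union> A) * (- 1) ^ nat \<bar>int (card C) - (r (C \<union> A) - r A)\<bar>)) =
        (\<Sum>A\<in>Pow E. \<Sum>B | B \<in> Pow E \<and> B \<subseteq> A. \<Sum>D | D \<in> Pow E \<and> A \<subseteq> D.
            f B * g D * s B D * (- 1) ^ card A)"
  proof (rule sum.cong [OF refl])
    fix A assume A: "A \<in> Pow E"
    then have "{B \<in> Pow E. B \<subseteq> A} = Pow A"
      by auto
    moreover have "f B * (- 1) ^ nat \<bar>r A - r B\<bar> *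
          (g D * (- 1) ^ nat \<bar>int (card (D - A)) - (r D - r A)\<bar>) =
        f B * g D * s B D * (- 1) ^ card A" if "D \<subseteq> E" "A \<subseteq> D" for B D
      using arg_cong [OF signs [OF that, of B], of "\<lambda>t. f B * g D * t"] by (simp add: ac_simps)
    ultimately show
      "(\<Sum>B\<in>Pow A. f B * (- 1) ^ nat \<bar>r A - r B\<bar>) *
       (\<Sum>C\<in>Pow (E - A). g (C \<union> A) * (- 1) ^ nat \<bar>int (card C) - (r (C \<union> A) - r A)\<bar>) =
       (\<Sum>B | B \<in> Pow E \<and> B \<subseteq> A. \<Sum>D | D \<in> Pow E \<and> A \<subseteq> D. f B * g D * s B D * (- 1) ^ card A)"
      using A sum_contraction_eq_sum_superset
        [of A E "\<lambda>C D. g D * (- 1) ^ nat \<bar>int (card C) - (r D - r A)\<bar>"]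
      by (simp add: sum_product)
  qed
  \<comment> \<open>This interchange and the next one make \<open>A\<close> the innermost variable,
    so that \<open>f B * g D * s B D\<close> can be pulled out of the alternating sum.\<close>
  also have "\<dots> = (\<Sum>B\<in>Pow E. \<Sum>A | A \<in> Pow E \<and> B \<subseteq> A. \<Sum>D | D \<in> Pow E \<and> A \<subseteq> D.
            f B * g D * s B D * (- 1) ^ card A)"
    using E by (intro sum.swap_restrict) auto
  also have "\<dots> = (\<Sum>B\<in>Pow E. \<Sum>D\<in>Pow E. \<Sum>A | A \<in> Pow E \<and> B \<subseteq> A \<and> A \<subseteq> D.
            f B * g D * s B D * (- 1) ^ card A)"
  proof (rule sum.cong [OF refl])
    fix B
    show "(\<Sum>A | A \<in> Pow E \<and> B \<subseteq> A. \<Sum>D | D \<in> Pow E \<and> A \<subseteq> D. f B * g D * s B D * (- 1) ^ card A) =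
        (\<Sum>D\<in>Pow E. \<Sum>A | A \<in> Pow E \<and> B \<subseteq> A \<and> A \<subseteq> D. f B * g D * s B D * (- 1) ^ card A)"
      using E by (subst sum.swap_restrict) (simp_all add: conj_assoc)
  qed
  also have "\<dots> = (\<Sum>B\<in>Pow E. \<Sum>D\<in>Pow E. if B = D then f B * g B * (s B B * (- 1) ^ card B) else 0)"
    by (intro sum.cong refl)
       (simp add: sum_alternating_interval [OF E] mult.assoc flip: sum_distrib_left)
  also have "\<dots> = (\<Sum>B\<in>Pow E. f B * g B * (s B B * (- 1) ^ card B))"
    using E by simp
  \<comment> \<open>On the diagonal the exponent in \<open>s B B\<close> is
    \<open>card B - 2 * r B\<close>, up to absolute value, so \<open>s B B\<close> equals
    \<open>(- 1) ^ card B\<close> and the two signs multiply to 1.\<close>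
  also have "\<dots> = (\<Sum>B\<in>Pow E. f B * g B)"
    by (intro sum.cong refl) (auto simp: s_def minus_one_power_iff even_nat_iff)
  finally show ?thesis .
qed

text \<open>Since \<open>- 1\<close> is its own inverse, the sign of the exponent is irrelevant. The
  base is written \<open>0 - 1\<close> because it arises from substituting 0 for a variable.\<close>

lemma powi_minus_1_total_fract:
  "(0 - 1 :: 'a::comm_ring_1 total_fract) powi k = (- 1) ^ nat \<bar>k\<bar>"
proof -
  have "inverse (- 1 :: 'a total_fract) = - 1"
    by (rule inverse_total_fract_unique) simp
  then show ?thesis
    by (simp add: power_int_def)
qed

theorem theorem1p1:
  fixes M :: "('e, 'r::comm_ring_1) ranked_set"
  assumes "ranked_set_with_multiplicities M"
  shows "arith_tutte M var_x var_y =
           (\<Sum>A\<in>Pow (ground M).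
              arith_tutte (restriction M A) 0 var_y * tutte (contraction M A) var_x 0)
       \<and> arith_tutte M var_x var_y =
           (\<Sum>A\<in>Pow (ground M).
              tutte (restriction M A) 0 var_y * arith_tutte (contraction M A) var_x 0)"
proof -
  define c :: "'e set \<Rightarrow> 'r ratfun" where "c A = Const (mult M A)" for A
  define u :: "'e set \<Rightarrow> 'r ratfun"
    where "u A = (var_x - 1) powi (rk M (ground M) - rk M A)" for A
  define v :: "'e set \<Rightarrow> 'r ratfun"
    where "v A = (var_y - 1) powi (int (card A) - rk M A)" for A
  have E: "finite (ground M)"
    using assms by (simp add: ranked_set_with_multiplicities_def)
  \<comment> \<open>The same summand is split in two ways: the multiplicity \<open>c\<close> goes
    with the restriction factor \<open>v\<close> for the first identity and with the contraction
    factor \<open>u\<close> for the second.\<close>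
  have "arith_tutte M var_x var_y = (\<Sum>A\<in>Pow (ground M). c A * v A * u A)"
    "arith_tutte M var_x var_y = (\<Sum>A\<in>Pow (ground M). v A * (c A * u A))"
    by (simp_all add: arith_tutte_def c_def u_def v_def ac_simps)
  moreover have
    "arith_tutte (restriction M A) 0 var_y =
       (\<Sum>B\<in>Pow A. c B * v B * (- 1) ^ nat \<bar>rk M A - rk M B\<bar>)"
    "tutte (restriction M A) 0 var_y = (\<Sum>B\<in>Pow A. v B * (- 1) ^ nat \<bar>rk M A - rk M B\<bar>)" for A
    by (simp_all only: arith_tutte_def tutte_def restriction_def ranked_set.simps
          powi_minus_1_total_fract c_def v_def ac_simps)
  moreover have
    "arith_tutte (contraction M A) var_x 0 =
       (\<Sum>C\<in>Pow (ground M - A). c (C \<union> A) * u (C \<union> A) *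
          (- 1) ^ nat \<bar>int (card C) - (rk M (C \<union> A) - rk M A)\<bar>)"
    "tutte (contraction M A) var_x 0 =
       (\<Sum>C\<in>Pow (ground M - A). u (C \<union> A) *
          (- 1) ^ nat \<bar>int (card C) - (rk M (C \<union> A) - rk M A)\<bar>)" if "A \<in> Pow (ground M)" for A
  proof -
    \<comment> \<open>The total rank of the contraction is evaluated at this union. The two copies
      of \<open>rk M A\<close> then cancel in the exponent of \<open>var_x - 1\<close>, which
      therefore depends only on \<open>C \<union> A\<close>.\<close>
    have "ground M - A \<union> A = ground M"
      using that by auto
    then show "arith_tutte (contraction M A) var_x 0 =
       (\<Sum>C\<in>Pow (ground M - A). c (C \<union> A) * u (C \<union> A) *
          (- 1) ^ nat \<bar>int (card C) - (rk M (C \<union> A) - rk M A)\<bar>)"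
      "tutte (contraction M A) var_x 0 =
       (\<Sum>C\<in>Pow (ground M - A). u (C \<union> A) *
          (- 1) ^ nat \<bar>int (card C) - (rk M (C \<union> A) - rk M A)\<bar>)"
      by (simp_all only: arith_tutte_def tutte_def contraction_def ranked_set.simps
            powi_minus_1_total_fract c_def u_def diff_diff_eq2 diff_add_cancel)
  qed
  ultimately show ?thesis
    using convolution_rank_signs [OF E, of "\<lambda>A. c A * v A" "rk M" u]
      convolution_rank_signs [OF E, of v "rk M" "\<lambda>A. c A * u A"]
    by (simp only: cong: sum.cong)
qed

end
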